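(* The core-minus partial order implies the minus partial order: for $A,B\in\mathbb{C}_{n,n}$, if $A\overset{\mathtt{CM}}{\le}B$, then $A\overset{-}{\le}B$.
   Context: $\mathbb{C}_{n,n}$ is the set of $n\times n$ complex matrices, $A^\ast$ is the conjugate transpose, $\mathrm{rk}$ the rank, $\mathcal{R}(A)$ the column space, $A^\dag$ the Moore-Penrose inverse. The index $\mathrm{Ind}(A)$ is $0$ if $A$ is non-singular, and otherwise is the smallest positive integer $k$ with $\mathrm{rk}(A^{k+1})=\mathrm{rk}(A^k)$. $\mathbb{C}_n^{\mathtt{CM}}=\{A\in\mathbb{C}_{n,n} : \mathrm{rk}(A^2)=\mathrm{rk}(A)\}$ (core-invertible matrices). Core-EP decomposition: for $A\in\mathbb{C}_{n,n}$ with $\mathrm{Ind}(A)=k$, it is the (existing and unique) decomposition $A=A_1+A_2$ with $A_1\in\mathbb{C}_n^{\mathtt{CM}}$, $A_2^k=0$ (read as $A_2=0$ when $k=0$), and $A_1^\ast A_2=A_2A_1=0$. Core inverse: for $A\in\mathbb{C}_n^{\mathtt{CM}}$, $A^{(\#)}$ is the unique $X\in\mathbb{C}_{n,n}$ with $AX=AA^\dag$ and $\mathcal{R}(X)\subseteq\mathcal{R}(A)$. Core partial order: for $A,B\in\mathbb{C}_n^{\mathtt{CM}}$, $A\overset{(\#)}{\le}B$ means $A^{(\#)}A=A^{(\#)}B$ and $AA^{(\#)}=BA^{(\#)}$. Minus partial order: $A\overset{-}{\le}B$ means $\mathrm{rk}(B)-\mathrm{rk}(A)=\mathrm{rk}(B-A)$.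 Core-minus order: for $A,B\in\mathbb{C}_{n,n}$ with core-EP decompositions $A=A_1+A_2$ and $B=B_1+B_2$ ($A_1,B_1$ core-invertible, $A_2,B_2$ nilpotent), $A\overset{\mathtt{CM}}{\le}B$ means $A_1\overset{(\#)}{\le}B_1$ and $A_2\overset{-}{\le}B_2$. *)

theory Defs
  imports "HOL-Analysis.Analysis"
begin

definition conj_transpose :: "complex^'n^'m \<Rightarrow> complex^'m^'n"
  where "conj_transpose A = map_matrix cnj (transpose A)"

text \<open>The overloaded power \<open>A ^ k\<close> on type \<open>vec\<close> is componentwise, so the matrix power is
  defined separately.\<close>

primrec mat_power :: "'a::semiring_1^'n^'n \<Rightarrow> nat \<Rightarrow> 'a^'n^'n" where
  "mat_power A 0 = mat 1"
| "mat_power A (Suc k) = A ** mat_power A k"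

definition column_space :: "'a::semiring_1^'n^'m \<Rightarrow> ('a^'m) set"
  where "column_space A = range (\<lambda>x. A *v x)"

definition mat_index :: "'a::field^'n^'n \<Rightarrow> nat"
  where "mat_index A =
    (if invertible A then 0
     else LEAST k. 0 < k \<and> rank (mat_power A (k + 1)) = rank (mat_power A k))"

definition is_moore_penrose :: "complex^'n^'m \<Rightarrow> complex^'m^'n \<Rightarrow> bool"
  where "is_moore_penrose A X \<longleftrightarrow>
    A ** X ** A = A \<and> X ** A ** X = X \<and>
    conj_transpose (A ** X) = A ** X \<and> conj_transpose (X ** A) = X ** A"

definition moore_penrose :: "complex^'n^'m \<Rightarrow> complex^'m^'n"
  where "moore_penrose A = (THE X. is_moore_penrose A X)"

definition core_invertible :: "complex^'n^'n \<Rightarrow> bool"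
  where "core_invertible A \<longleftrightarrow> rank (mat_power A 2) = rank A"

text \<open>Meaningful only for core-invertible \<open>A\<close>; otherwise no such \<open>X\<close> need exist.\<close>

definition core_inverse :: "complex^'n^'n \<Rightarrow> complex^'n^'n"
  where "core_inverse A =
    (THE X. A ** X = A ** moore_penrose A \<and> column_space X \<subseteq> column_space A)"

definition core_le :: "complex^'n^'n \<Rightarrow> complex^'n^'n \<Rightarrow> bool"
  where "core_le A B \<longleftrightarrow> core_invertible A \<and> core_invertible B \<and>
    core_inverse A ** A = core_inverse A ** B \<and>
    A ** core_inverse A = B ** core_inverse A"

text \<open>The ranks are cast to \<open>int\<close> to avoid truncated subtraction.\<close>

definition minus_le :: "complex^'n^'n \<Rightarrow> complex^'n^'n \<Rightarrow> bool"
  where "minus_le A B \<longleftrightarrow> int (rank B) - int (rank A) = int (rank (B - A))"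

text \<open>For index \<open>0\<close> the nilpotency condition is read as \<open>A\<^sub>2 = 0\<close>, not literally as
  \<open>A\<^sub>2\<^sup>0 = 0\<close>, which would be unsatisfiable.\<close>

definition core_EP_decomp :: "complex^'n^'n \<Rightarrow> complex^'n^'n \<Rightarrow> complex^'n^'n \<Rightarrow> bool"
  where "core_EP_decomp A A1 A2 \<longleftrightarrow>
    A = A1 + A2 \<and> core_invertible A1 \<and>
    (if mat_index A = 0 then A2 = 0 else mat_power A2 (mat_index A) = 0) \<and>
    conj_transpose A1 ** A2 = 0 \<and> A2 ** A1 = 0"

text \<open>The core-EP decomposition exists and is unique for every matrix, so the existential
  quantifiers below merely name the parts of the decompositions of \<open>A\<close> and \<open>B\<close>.\<close>

definition core_minus_le :: "complex^'n^'n \<Rightarrow> complex^'n^'n \<Rightarrow> bool"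
  where "core_minus_le A B \<longleftrightarrow>
    (\<exists>A1 A2 B1 B2. core_EP_decomp A A1 A2 \<and> core_EP_decomp B B1 B2 \<and>
       core_le A1 B1 \<and> minus_le A2 B2)"

end

theory Submission
  imports Defs
begin

text \<open>The minus order \<open>A \<le> B\<close> says that \<open>B = A + (B - A)\<close> has additive ranks; by subadditivity of
  the rank only \<open>rank A + rank (B - A) \<le> rank B\<close> has to be shown. Both a core-EP decomposition
  \<open>A = A\<^sub>1 + A\<^sub>2\<close> and a pair \<open>A\<^sub>1\<close>, \<open>B\<^sub>1 - A\<^sub>1\<close> with \<open>A\<^sub>1\<close> below \<open>B\<^sub>1\<close> in the core order
  consist of two matrices whose column spaces meet trivially and lie in that of their sum, so ranks
  add up. Hence \<open>rank (B - A) \<le> rank (B\<^sub>1 - A\<^sub>1) + rank (B\<^sub>2 - A\<^sub>2)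
    = rank B\<^sub>1 + rank B\<^sub>2 - rank A\<^sub>1 - rank A\<^sub>2 = rank B - rank A\<close>.\<close>

section \<open>Rank and column space over a field\<close>

lemma column_in_column_space: "column j A \<in> column_space A"
  for A :: "'a::field^'n^'m"
proof -
  have "column j A = A *v axis j 1"
    by (simp add: vec_eq_iff column_def matrix_vector_mult_def axis_def if_distrib cong: if_cong)
  then show ?thesis
    by (simp add: column_space_def)
qed

lemma span_columns: "vec.span (columns A) = column_space A"
  for A :: "'a::field^'n^'m"
proof
  have "columns A \<subseteq> column_space A"
    by (auto simp: columns_def column_in_column_space)
  then show "vec.span (columns A) \<subseteq> column_space A"
    unfolding column_space_def
    by (intro vec.span_minimal vec.linear_subspace_image matrix_vector_mul_linear_gen) auto
qed (auto simp: column_space_def matrix_vector_mult_in_columnspace_gen)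

text \<open>Expanding each row in a basis \<open>B\<close> of the row space gives coefficients
  \<open>c i b\<close>. Read column by column, the same expansion shows that the vectors
  \<open>\<chi> i. c i b\<close>, at most one per basis element, span all columns.\<close>

lemma dim_columns_le_dim_rows: "vec.dim (columns A) \<le> vec.dim (rows A)"
  for A :: "'a::field^'n^'m"
proof -
  obtain B where B: "B \<subseteq> rows A" "vec.independent B" "rows A \<subseteq> vec.span B" "card B = vec.dim (rows A)"
    using vec.basis_exists by blast
  then have "finite B"
    using vec.finiteI_independent by blast
  have "\<exists>c. row i A = (\<Sum>b\<in>B. c b *s b)" for i
  proof -
    have "row i A \<in> vec.span B"
      using B(3) by (auto simp: rows_def)
    then show ?thesis
      by (auto simp: vec.span_finite[OF \<open>finite B\<close>])
  qed
  then obtain c where c: "row i A = (\<Sum>b\<in>B. c i b *s b)" for i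
    by metis
  let ?C = "(\<lambda>b. \<chi> i. c i b) ` B"
  have "column j A = (\<Sum>b\<in>B. (b $ j) *s (\<chi> i. c i b))" for j
  proof -
    have "column j A $ i = (\<Sum>b\<in>B. (b $ j) *s (\<chi> i. c i b)) $ i" for i
      using arg_cong[OF c[of i], of "\<lambda>v. v $ j"] by (simp add: row_def column_def mult.commute)
    then show ?thesis
      by (simp add: vec_eq_iff)
  qed
  then have "columns A \<subseteq> vec.span ?C"
    by (auto simp: columns_def intro!: vec.span_sum vec.span_scale intro: vec.span_base)
  then have "vec.dim (columns A) \<le> card ?C"
    using \<open>finite B\<close> by (intro vec.dim_le_card) auto
  also have "\<dots> \<le> vec.dim (rows A)"
    using card_image_le[OF \<open>finite B\<close>] B(4) by metis
  finally show ?thesis .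
qed

text \<open>\<open>rank\<close> is by definition the dimension of the span of the rows. The
  preceding inequality, applied to \<open>A\<close> and to its transpose, moves it to columns, where
  all later rank arguments take place.\<close>

lemma rank_dim_column_space: "rank A = vec.dim (column_space A)"
  for A :: "'a::field^'n^'m"
proof -
  have "vec.dim (rows A) = vec.dim (columns A)"
    by (metis columns_transpose dim_columns_le_dim_rows le_antisym rows_transpose)
  then show ?thesis
    by (metis row_rank_def_gen span_columns vec.dim_span)
qed

lemma subspace_column_space: "vec.subspace (column_space A)"
  for A :: "'a::field^'n^'m"
  by (metis span_columns vec.subspace_span)

lemma column_space_mult_subset: "column_space (A ** B) \<subseteq> column_space A"
  by (auto simp: column_space_def simp flip: matrix_vector_mul_assoc)

lemma column_space_mult: "column_space (A ** B) = (*v) A ` column_space B"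
  by (auto simp: column_space_def image_image matrix_vector_mul_assoc)

lemma column_space_subset_imp_factor:
  fixes A :: "'a::field^'n^'m" and B :: "'a^'k^'m"
  assumes "column_space B \<subseteq> column_space A"
  obtains Y where "B = A ** Y"
proof -
  have "\<exists>y. column j B = A *v y" for j
  proof -
    have "column j B \<in> column_space A"
      using assms column_in_column_space by blast
    then show ?thesis
      by (auto simp: column_space_def)
  qed
  then obtain y where y: "column j B = A *v y j" for j
    by metis
  have "B = A ** (\<chi> i j. y j $ i)"
    using y by (simp add: vec_eq_iff column_def matrix_matrix_mult_def matrix_vector_mult_def)
  then show thesis ..
qed

lemma rank_mult_le_left: "rank (A ** B) \<le> rank A"
  for A :: "'a::field^'n^'m"
  by (simp add: rank_dim_column_space column_space_mult_subset vec.dim_subset)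

text \<open>The inclusion of column spaces becomes an equality by dimension. This turns hypotheses
  on ranks into matrix equations.\<close>

lemma rank_eq_imp_factor:
  fixes A :: "'a::field^'n^'m"
  assumes "rank (A ** B) = rank A"
  obtains Y where "A = A ** B ** Y"
proof (rule column_space_subset_imp_factor)
  show "column_space A \<subseteq> column_space (A ** B)"
    using vec.subspace_dim_equal[OF subspace_column_space subspace_column_space
        column_space_mult_subset[of A B]] assms
    by (simp add: rank_dim_column_space)
qed

lemma rank_add_le: "rank (A + B) \<le> rank A + rank B"
  for A B :: "'a::field^'n^'m"
proof -
  let ?S = "{x + y |x y. x \<in> column_space A \<and> y \<in> column_space B}"
  have "column_space (A + B) \<subseteq> ?S"
    by (auto simp: column_space_def matrix_vector_mult_add_rdistrib)
  then have "rank (A + B) \<le> vec.dim ?S"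
    by (simp add: rank_dim_column_space vec.dim_subset)
  then show ?thesis
    using vec.dim_sums_Int[OF subspace_column_space[of A] subspace_column_space[of B]]
    by (simp add: rank_dim_column_space)
qed

text \<open>The sum of the two column spaces lies in that of \<open>C\<close>, and it is direct by
  the third assumption, so dimensions add.\<close>

lemma rank_add_rank_le:
  fixes A :: "'a::field^'n^'m" and B :: "'a^'k^'m" and C :: "'a^'l^'m"
  assumes "column_space A \<subseteq> column_space C" "column_space B \<subseteq> column_space C"
    and "\<And>x y. A *v x = B *v y \<Longrightarrow> A *v x = 0"
  shows "rank A + rank B \<le> rank C"
proof -
  let ?S = "{x + y |x y. x \<in> column_space A \<and> y \<in> column_space B}"
  have "?S \<subseteq> column_space C"
    using assms(1,2) vec.subspace_add[OF subspace_column_space[of C]] by blast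
  then have "vec.dim ?S \<le> rank C"
    by (simp add: rank_dim_column_space vec.dim_subset)
  moreover have "column_space A \<inter> column_space B \<subseteq> {0}"
    using assms(3) by (auto simp: column_space_def)
  then have "vec.dim (column_space A \<inter> column_space B) = 0"
    by (simp only: vec.dim_eq_0)
  ultimately show ?thesis
    using vec.dim_sums_Int[OF subspace_column_space[of A] subspace_column_space[of B]]
    by (simp only: rank_dim_column_space)
qed

lemma matrix_diff_distrib_left: "A ** (B - C) = A ** B - A ** C"
  for A :: "'a::ring_1^'n^'m"
  by (simp add: vec_eq_iff matrix_matrix_mult_def right_diff_distrib sum_subtractf)

section \<open>The conjugate transpose and the Moore-Penrose inverse\<close>

lemma conj_transpose_conj_transpose [simp]: "conj_transpose (conj_transpose A) = A"
  by (simp add: conj_transpose_def vec_eq_iff transpose_def)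

lemma conj_transpose_mult: "conj_transpose (A ** B) = conj_transpose B ** conj_transpose A"
  by (simp add: conj_transpose_def vec_eq_iff transpose_def matrix_matrix_mult_def mult.commute)

text \<open>With \<open>y = A *v x\<close>, the squared norm of \<open>y\<close> is the inner
  product of \<open>x\<close> with \<open>conj_transpose A *v y\<close>, hence zero.\<close>

lemma conj_transpose_mult_self_eq_0:
  fixes A :: "complex^'n^'m"
  assumes "conj_transpose A *v (A *v x) = 0"
  shows "A *v x = 0"
proof -
  let ?y = "A *v x"
  have "(\<Sum>i\<in>UNIV. cnj (?y $ i) * ?y $ i)
      = (\<Sum>i\<in>UNIV. \<Sum>j\<in>UNIV. cnj (x $ j) * (cnj (A $ i $ j) * ?y $ i))"
    by (subst (1) matrix_vector_mult_def) (simp add: sum_distrib_left mult_ac)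
  also have "\<dots> = (\<Sum>j\<in>UNIV. cnj (x $ j) * (conj_transpose A *v ?y) $ j)"
    by (subst sum.swap)
      (simp add: conj_transpose_def transpose_def matrix_vector_mult_def[of "map_matrix _ _"]
        sum_distrib_left)
  finally have "complex_of_real (\<Sum>i\<in>UNIV. (cmod (?y $ i))\<^sup>2) = 0"
    unfolding of_real_sum complex_norm_square using assms by (simp add: mult.commute)
  then have "(\<Sum>i\<in>UNIV. (cmod (?y $ i))\<^sup>2) = 0"
    using of_real_eq_0_iff by blast
  then show ?thesis
    by (simp add: sum_nonneg_eq_0_iff vec_eq_iff)
qed

lemma rank_conj_transpose_mult_self: "rank (conj_transpose A ** A) = rank A"
proof -
  have "inj_on ((*v) (conj_transpose A)) (column_space A)"
  proof (rule inj_onI)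
    fix u v
    assume "u \<in> column_space A" "v \<in> column_space A" "conj_transpose A *v u = conj_transpose A *v v"
    moreover from this obtain x where "u - v = A *v x"
      by (auto simp: column_space_def simp flip: matrix_vector_mult_diff_distrib)
    ultimately show "u = v"
      using conj_transpose_mult_self_eq_0[of A x] by (simp add: matrix_vector_mult_diff_distrib flip: \<open>u - v = _\<close>)
  qed
  then have "inj_on ((*v) (conj_transpose A)) (vec.span (column_space A))"
    by (simp add: vec.span_eq_iff[THEN iffD2] subspace_column_space)
  then show ?thesis
    by (simp add: rank_dim_column_space column_space_mult vec.dim_image_eq
        matrix_vector_mul_linear_gen)
qed

text \<open>The product \<open>conj_transpose A ** A\<close> has the rank of \<open>A\<close> and at
  most the rank of its left factor; exchanging \<open>A\<close> and \<open>conj_transpose A\<close>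
  gives the other inequality.\<close>

lemma rank_conj_transpose: "rank (conj_transpose A) = rank A"
proof -
  have "rank B \<le> rank (conj_transpose B)" for B :: "complex^'k^'l"
    by (metis rank_conj_transpose_mult_self rank_mult_le_left)
  from this[of A] this[of "conj_transpose A"] show ?thesis
    by simp
qed

lemma is_moore_penrose_exists: "\<exists>X. is_moore_penrose A X"
proof -
  have "\<exists>U. conj_transpose B = conj_transpose B ** B ** U" for B :: "complex^'k^'l"
    by (metis rank_eq_imp_factor rank_conj_transpose rank_conj_transpose_mult_self)
  from this[of A] this[of "conj_transpose A"] obtain U V
    where U: "conj_transpose A = conj_transpose A ** A ** U"
      and V: "A = A ** conj_transpose A ** V"
    by auto
  \<comment> \<open>\<open>P\<close> and \<open>Q\<close> turn out to be the orthogonal projectors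
    onto the column spaces of \<open>A\<close> and \<open>conj_transpose A\<close>. The inverse
    sought is \<open>Q ** U\<close>, whose products with \<open>A\<close> are \<open>P\<close> on
    one side and \<open>Q\<close> on the other.\<close>
  define P where "P = A ** U"
  define Q where "Q = conj_transpose V ** A"
  have UP: "conj_transpose U ** conj_transpose A ** A = A"
    using arg_cong[OF U, of conj_transpose] by (simp add: conj_transpose_mult matrix_mul_assoc)
  have VQ: "conj_transpose V ** A ** conj_transpose A = conj_transpose A"
    using arg_cong[OF V, of conj_transpose] by (simp add: conj_transpose_mult matrix_mul_assoc)
  have P: "conj_transpose P = conj_transpose U ** conj_transpose A"
    by (simp add: P_def conj_transpose_mult)
  have P': "conj_transpose P = P"
    by (metis P P_def UP U matrix_mul_assoc)
  have Q: "conj_transpose Q = conj_transpose A ** V"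
    by (simp add: Q_def conj_transpose_mult)
  have Q': "conj_transpose Q = Q"
    by (metis Q Q_def VQ V matrix_mul_assoc)
  have PA: "P ** A = A"
    using P P' UP by simp
  have AQ: "A ** Q = A"
    using Q Q' V by (simp add: matrix_mul_assoc)
  have QQ: "Q ** Q = Q"
    by (metis AQ Q_def matrix_mul_assoc)
  have AX: "A ** (Q ** U) = P"
    by (simp add: matrix_mul_assoc AQ P_def)
  have XA: "Q ** U ** A = Q"
    by (metis PA P_def Q_def matrix_mul_assoc)
  have "is_moore_penrose A (Q ** U)"
    unfolding is_moore_penrose_def AX XA by (simp add: PA P' Q' matrix_mul_assoc QQ)
  then show ?thesis ..
qed

lemma is_moore_penrose_unique:
  assumes "is_moore_penrose A X" "is_moore_penrose A Y"
  shows "X = Y"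
proof -
  note X = assms(1)[unfolded is_moore_penrose_def]
  note Y = assms(2)[unfolded is_moore_penrose_def]
  have "A ** X = conj_transpose (A ** Y ** (A ** X))"
    using X Y by (simp add: matrix_mul_assoc)
  also have "\<dots> = A ** X ** (A ** Y)"
    using X Y by (simp only: conj_transpose_mult[of "A ** Y" "A ** X"])
  finally have AX: "A ** X = A ** Y"
    using X by (simp add: matrix_mul_assoc)
  have "X ** A = conj_transpose (X ** A ** (Y ** A))"
    using X Y by (metis matrix_mul_assoc)
  also have "\<dots> = Y ** A ** (X ** A)"
    using X Y by (simp only: conj_transpose_mult[of "X ** A" "Y ** A"])
  finally have XA: "X ** A = Y ** A"
    using X by (metis matrix_mul_assoc)
  \<comment> \<open>The chain is
    \<open>X = X ** A ** X = Y ** A ** X = Y ** A ** Y = Y\<close>.\<close>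
  show ?thesis
    using X Y AX XA by (metis matrix_mul_assoc)
qed

lemma is_moore_penrose_moore_penrose: "is_moore_penrose A (moore_penrose A)"
  unfolding moore_penrose_def
  using is_moore_penrose_exists is_moore_penrose_unique by (metis theI)

section \<open>Core-invertible matrices and the core-minus order\<close>

lemma core_invertible_factor_right:
  assumes "core_invertible A"
  obtains Y where "A = A ** A ** Y"
  using assms rank_eq_imp_factor[of A A]
  by (auto simp: core_invertible_def numeral_2_eq_2)

text \<open>Core invertibility passes to the conjugate transpose, so the right factorization can be
  transposed back.\<close>

lemma core_invertible_factor_left:
  assumes "core_invertible A"
  obtains W where "A = W ** A ** A"
proof -
  have "core_invertible (conj_transpose A)"
    using assms rank_conj_transpose[of A] rank_conj_transpose[of "A ** A"]
    by (simp add: core_invertible_def numeral_2_eq_2 conj_transpose_mult)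
  then obtain Y where "conj_transpose A = conj_transpose A ** conj_transpose A ** Y"
    by (rule core_invertible_factor_right)
  from arg_cong[OF this, of conj_transpose] have "A = conj_transpose Y ** A ** A"
    by (simp add: conj_transpose_mult matrix_mul_assoc)
  then show thesis ..
qed

text \<open>The core inverse is an inner inverse because \<open>A ** core_inverse A\<close> equals
  \<open>A ** moore_penrose A\<close>. To use this equation, the definite description must first be
  shown to denote.\<close>

lemma core_inverse_mult_self:
  assumes "core_invertible A"
  shows "A ** core_inverse A ** A = A"
proof -
  let ?M = "moore_penrose A"
  obtain Y where Y: "A = A ** A ** Y"
    using assms by (rule core_invertible_factor_right)
  obtain W where W: "A = W ** A ** A"
    using assms by (rule core_invertible_factor_left)
  have "\<exists>!X. A ** X = A ** ?M \<and> column_space X \<subseteq> column_space A"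
  proof (rule ex1I)
    show "A ** (A ** Y ** ?M) = A ** ?M \<and> column_space (A ** Y ** ?M) \<subseteq> column_space A"
      by (metis Y column_space_mult_subset matrix_mul_assoc)
  next
    fix X
    assume X: "A ** X = A ** ?M \<and> column_space X \<subseteq> column_space A"
    then obtain Z where Z: "X = A ** Z"
      by (metis column_space_subset_imp_factor)
    \<comment> \<open>\<open>W ** A\<close> acts as the identity on the column space of
      \<open>A\<close>, which contains that of \<open>X\<close>; hence \<open>A ** X\<close>
      determines \<open>X\<close>.\<close>
    have "X = W ** (A ** X)"
      by (metis W Z matrix_mul_assoc)
    also have "\<dots> = W ** (A ** (A ** Y ** ?M))"
      by (metis X Y matrix_mul_assoc)
    also have "\<dots> = A ** Y ** ?M"
      by (metis W matrix_mul_assoc)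
    finally show "X = A ** Y ** ?M" .
  qed
  then have "A ** core_inverse A = A ** ?M"
    unfolding core_inverse_def by (rule theI'[THEN conjunct1])
  then show ?thesis
    using is_moore_penrose_moore_penrose[of A] by (simp add: is_moore_penrose_def)
qed

lemma minus_le_iff: "minus_le A B \<longleftrightarrow> rank A + rank (B - A) \<le> rank B"
  using rank_add_le[of A "B - A"] by (auto simp: minus_le_def)

text \<open>The equation \<open>A = B ** ?X ** A\<close> puts both column spaces inside that of
  \<open>B\<close>. They meet trivially because \<open>A ** ?X\<close> fixes the column space of
  \<open>A\<close> and annihilates that of \<open>B - A\<close>.\<close>

lemma core_le_imp_minus_le:
  assumes "core_le A B"
  shows "minus_le A B"
  unfolding minus_le_iff
proof (rule rank_add_rank_le)
  let ?X = "core_inverse A"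
  have AXA: "A ** ?X ** A = A" and XB: "?X ** A = ?X ** B" and BX: "A ** ?X = B ** ?X"
    using assms core_inverse_mult_self[of A] unfolding core_le_def by blast+
  have A: "A = B ** (?X ** A)"
    by (metis AXA BX matrix_mul_assoc)
  then show "column_space A \<subseteq> column_space B"
    by (metis column_space_mult_subset)
  have "B - A = B ** (mat 1 - ?X ** A)"
    using A by (simp add: matrix_diff_distrib_left)
  then show "column_space (B - A) \<subseteq> column_space B"
    by (metis column_space_mult_subset)
  fix x y
  assume *: "A *v x = (B - A) *v y"
  have "A *v x = A ** ?X *v (A *v x)"
    by (simp add: matrix_vector_mul_assoc AXA)
  also have "\<dots> = A ** ?X ** (B - A) *v y"
    by (simp add: * matrix_vector_mul_assoc)
  also have "A ** ?X ** (B - A) = A ** (?X ** B - ?X ** A)"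
    by (simp add: matrix_diff_distrib_left matrix_mul_assoc)
  also have "\<dots> = 0"
    using XB by simp
  finally show "A *v x = 0"
    by simp
qed

text \<open>From \<open>A\<^sub>2 ** A\<^sub>1 = 0\<close> follows
  \<open>A ** A\<^sub>1 = A\<^sub>1 ** A\<^sub>1\<close>, so core invertibility of
  \<open>A\<^sub>1\<close> places its column space, and then that of \<open>A\<^sub>2\<close>,
  inside that of \<open>A\<close>. The condition
  \<open>conj_transpose A\<^sub>1 ** A\<^sub>2 = 0\<close> makes the two orthogonal.\<close>

lemma core_EP_decomp_rank:
  assumes "core_EP_decomp A A\<^sub>1 A\<^sub>2"
  shows "rank A = rank A\<^sub>1 + rank A\<^sub>2"
proof (rule antisym)
  have A: "A = A\<^sub>1 + A\<^sub>2" and "core_invertible A\<^sub>1" and orth: "conj_transpose A\<^sub>1 ** A\<^sub>2 = 0"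
    and "A\<^sub>2 ** A\<^sub>1 = 0"
    using assms by (auto simp: core_EP_decomp_def)
  then show "rank A \<le> rank A\<^sub>1 + rank A\<^sub>2"
    using rank_add_le by simp
  obtain Y where Y: "A\<^sub>1 = A\<^sub>1 ** A\<^sub>1 ** Y"
    using \<open>core_invertible A\<^sub>1\<close> by (rule core_invertible_factor_right)
  have "A ** A\<^sub>1 = A\<^sub>1 ** A\<^sub>1"
    using \<open>A\<^sub>2 ** A\<^sub>1 = 0\<close> by (simp add: A vec_eq_iff matrix_matrix_mult_def distrib_right sum.distrib)
  then have A1: "A\<^sub>1 = A ** (A\<^sub>1 ** Y)"
    by (metis Y matrix_mul_assoc)
  have "A\<^sub>2 = A - A\<^sub>1"
    by (simp add: A)
  also have "\<dots> = A ** (mat 1 - A\<^sub>1 ** Y)"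
    using A1 by (simp add: matrix_diff_distrib_left)
  finally have A2: "A\<^sub>2 = A ** (mat 1 - A\<^sub>1 ** Y)" .
  show "rank A\<^sub>1 + rank A\<^sub>2 \<le> rank A"
  proof (rule rank_add_rank_le)
    show "column_space A\<^sub>1 \<subseteq> column_space A" "column_space A\<^sub>2 \<subseteq> column_space A"
      by (metis A1 A2 column_space_mult_subset)+
    fix x y
    assume "A\<^sub>1 *v x = A\<^sub>2 *v y"
    then have "conj_transpose A\<^sub>1 *v (A\<^sub>1 *v x) = 0"
      by (simp add: matrix_vector_mul_assoc orth)
    then show "A\<^sub>1 *v x = 0"
      by (rule conj_transpose_mult_self_eq_0)
  qed
qed

theorem theorem5p2:
  fixes A B :: "complex^'n^'n"
  assumes "core_minus_le A B"
  shows "minus_le A B"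
proof -
  from assms obtain A\<^sub>1 A\<^sub>2 B\<^sub>1 B\<^sub>2 where A: "core_EP_decomp A A\<^sub>1 A\<^sub>2" and B: "core_EP_decomp B B\<^sub>1 B\<^sub>2"
    and "core_le A\<^sub>1 B\<^sub>1" and "minus_le A\<^sub>2 B\<^sub>2"
    unfolding core_minus_le_def by blast
  then have "rank A\<^sub>1 + rank (B\<^sub>1 - A\<^sub>1) \<le> rank B\<^sub>1" "rank A\<^sub>2 + rank (B\<^sub>2 - A\<^sub>2) \<le> rank B\<^sub>2"
    using core_le_imp_minus_le minus_le_iff by blast+
  moreover have "B - A = (B\<^sub>1 - A\<^sub>1) + (B\<^sub>2 - A\<^sub>2)"
    using A B by (simp add: core_EP_decomp_def)
  then have "rank (B - A) \<le> rank (B\<^sub>1 - A\<^sub>1) + rank (B\<^sub>2 - A\<^sub>2)"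
    using rank_add_le by metis
  ultimately show ?thesis
    using core_EP_decomp_rank[OF A] core_EP_decomp_rank[OF B] by (simp add: minus_le_iff)
qed

end
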